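(* Let $d \geq 2$ and $k$ be fixed positive integers. Then every $d$-Horton set $H$ with $n$ points contains at least $\Omega(n^{\min\{2^{d-1},k\}})$ $k$-islands in $H$ (the implied constant depending only on $d$ and $k$). If $k \leq 3 \cdot 2^{d-1}$, then $H$ even contains at least $\Omega(n^{\min\{2^{d-1},k\}})$ $k$-holes in $H$.
   Context: A finite set $S\subseteq\mathbb{R}^d$ is in general position if for every $i=1,\dots,d-1$ no $i+2$ points of $S$ lie in an $i$-dimensional affine subspace. A set $I$ of $k$ points of $S$ is a $k$-island in $S$ if $\mathrm{conv}(I)\cap S=I$; it is a $k$-hole if moreover $I$ is in convex position (equivalently, $I$ is in convex position and the interior of $\mathrm{conv}(I)$ contains no point of $S$). A set $Q\subseteq\mathbb{R}^d$ is in strongly general position if it is in general position and, for every $i=1,\dots,d-1$, no $(i+1)$-tuple of points of $Q$ spans an $i$-dimensional affine subspace parallel to the $(d-i)$-dimensional linear subspace containing the last $d-i$ coordinate axes. Let $\pi:\mathbb{R}^d\to\mathbb{R}^{d-1}$, $\pi(x_1,\dots,x_d)=(x_1,\dots,x_{d-1})$. If $Q=\{q_0,\dots,q_{n-1}\}$ is in strongly general position with the points ordered by increasing first coordinate, then for $m\in\mathbb{N}$ and $i\in\{0,\dots,m-1\}$ let $Q_{i,m}=\{q_j: j\equiv i \pmod m\}$. For $A,B\subseteq\mathbb{R}^d$ with $|A|,|B|\ge d$, $B$ is deep below $A$ (and $A$ high above $B$) if $B$ lies entirely below every hyperplane determined by $d$ points of $A$ and $A$ lies entirely above every hyperplane determined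 by $d$ points of $B$. For arbitrary finite $A',B'$, $B'$ is deep below $A'$ if there are $A\supseteq A'$, $B\supseteq B'$ with $|A|,|B|\ge d$ and $B$ deep below $A$. Let $p_2<p_3<p_4<\cdots$ be the primes ($p_2=2$, $p_3=3$, $p_4=5,\dots$). Every finite set in $\mathbb{R}$ is $1$-Horton. For $d\ge2$, a finite set $H\subseteq\mathbb{R}^d$ in strongly general position is $d$-Horton if either $|H|\le 1$, or: (i) if $d>2$ then $\pi(H)$ is $(d-1)$-Horton; (ii) for every $i\in\{0,\dots,p_d-1\}$ the set $H_{i,p_d}$ is $d$-Horton; (iii) every $I\subseteq\{0,\dots,p_d-1\}$ with $|I|\ge2$ can be partitioned into nonempty $J$ and $I\setminus J$ such that $\bigcup_{j\in J}H_{j,p_d}$ lies deep below $\bigcup_{i\in I\setminus J}H_{i,p_d}$. *)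

theory Defs
  imports "HOL-Analysis.Analysis" "HOL-Analysis.Finite_Function_Topology" "HOL-Computational_Algebra.Primes" "HOL-Library.Infinite_Set"
begin

text \<open>The Horton condition in dimension \<open>d\<close> refers to dimension \<open>d - 1\<close>, so the dimension cannot
  be a type. All the spaces \<open>\<real>\<^sup>d\<close> live in the real vector space of finitely supported sequences:
  \<open>\<real>\<^sup>d\<close> is \<open>coord_space d\<close>, and \<open>lookup x i\<close> is the coordinate \<open>x\<^sub>i\<^sub>+\<^sub>1\<close>.\<close>

type_synonym point = "nat \<Rightarrow>\<^sub>0 real"

definition coord_space :: "nat \<Rightarrow> point set" where
  "coord_space d = {x. Poly_Mapping.keys x \<subseteq> {..<d}}"

definition direction :: "point set \<Rightarrow> point set" where
  "direction A = {x - y | x y. x \<in> A \<and> y \<in> A}"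

definition affine_subspace :: "nat \<Rightarrow> nat \<Rightarrow> point set \<Rightarrow> bool" where
  "affine_subspace d i A \<longleftrightarrow>
     A \<subseteq> coord_space d \<and> A \<noteq> {} \<and> affine A \<and> dim (direction A) = i"

definition parallel_subspaces :: "point set \<Rightarrow> point set \<Rightarrow> bool" where
  "parallel_subspaces A B \<longleftrightarrow> direction A \<subseteq> direction B \<or> direction B \<subseteq> direction A"

definition last_axes_space :: "nat \<Rightarrow> nat \<Rightarrow> point set" where
  "last_axes_space d m = span {Poly_Mapping.single j 1 | j. d - m \<le> j \<and> j < d}"

definition general_position :: "nat \<Rightarrow> point set \<Rightarrow> bool" where
  "general_position d S \<longleftrightarrow>
     finite S \<and> S \<subseteq> coord_space d \<and>
     (\<forall>i\<in>{1..d - 1}. \<not> (\<exists>T A. T \<subseteq> S \<and> card T = i + 2 \<and> affine_subspace d i A \<and> T \<subseteq> A))"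

definition strongly_general_position :: "nat \<Rightarrow> point set \<Rightarrow> bool" where
  "strongly_general_position d Q \<longleftrightarrow>
     general_position d Q \<and>
     (\<forall>i\<in>{1..d - 1}. \<not> (\<exists>T\<subseteq>Q. card T = i + 1 \<and> affine_subspace d i (affine hull T) \<and>
        parallel_subspaces (affine hull T) (last_axes_space d (d - i))))"

definition first_coords :: "nat \<Rightarrow> point \<Rightarrow> point" where
  "first_coords m x = (\<Sum>i<m. Poly_Mapping.single i (Poly_Mapping.lookup x i))"

text \<open>In the order by increasing first coordinate, the index of \<open>q\<close> is the number of points
  with smaller first coordinate (in strongly general position, with \<open>d \<ge> 2\<close>, the first
  coordinates are distinct).\<close>

definition point_index :: "point set \<Rightarrow> point \<Rightarrow> nat" where
  "point_index Q q = card {r \<in> Q. Poly_Mapping.lookup r 0 < Poly_Mapping.lookup q 0}"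

definition residue_part :: "point set \<Rightarrow> nat \<Rightarrow> nat \<Rightarrow> point set" where
  "residue_part Q i m = {q \<in> Q. point_index Q q mod m = i mod m}"

text \<open>No point is below or above a vertical hyperplane: the first conjunct fails for a point off
  the hyperplane, and the second for a point on it.\<close>

definition lies_below :: "nat \<Rightarrow> point \<Rightarrow> point set \<Rightarrow> bool" where
  "lies_below d x P \<longleftrightarrow>
     (\<exists>y\<in>P. first_coords (d - 1) y = first_coords (d - 1) x) \<and>
     (\<forall>y\<in>P. first_coords (d - 1) y = first_coords (d - 1) x \<longrightarrow>
        Poly_Mapping.lookup x (d - 1) < Poly_Mapping.lookup y (d - 1))"

definition lies_above :: "nat \<Rightarrow> point \<Rightarrow> point set \<Rightarrow> bool" where
  "lies_above d x P \<longleftrightarrow>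
     (\<exists>y\<in>P. first_coords (d - 1) y = first_coords (d - 1) x) \<and>
     (\<forall>y\<in>P. first_coords (d - 1) y = first_coords (d - 1) x \<longrightarrow>
        Poly_Mapping.lookup y (d - 1) < Poly_Mapping.lookup x (d - 1))"

definition determined_hyperplanes :: "nat \<Rightarrow> point set \<Rightarrow> point set set" where
  "determined_hyperplanes d A =
     {affine hull T | T. T \<subseteq> A \<and> card T = d \<and> affine_subspace d (d - 1) (affine hull T)}"

definition deep_below_large :: "nat \<Rightarrow> point set \<Rightarrow> point set \<Rightarrow> bool" where
  "deep_below_large d B A \<longleftrightarrow>
     (\<forall>P\<in>determined_hyperplanes d A. \<forall>b\<in>B. lies_below d b P) \<and>
     (\<forall>P\<in>determined_hyperplanes d B. \<forall>a\<in>A. lies_above d a P)"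

definition deep_below :: "nat \<Rightarrow> point set \<Rightarrow> point set \<Rightarrow> bool" where
  "deep_below d B' A' \<longleftrightarrow>
     (\<exists>A B. A' \<subseteq> A \<and> B' \<subseteq> B \<and> finite A \<and> finite B \<and> A \<subseteq> coord_space d \<and> B \<subseteq> coord_space d \<and>
        d \<le> card A \<and> d \<le> card B \<and> deep_below_large d B A)"

definition horton_prime :: "nat \<Rightarrow> nat" where
  "horton_prime d = enumerate {p. prime p} (d - 2)"

inductive horton :: "nat \<Rightarrow> point set \<Rightarrow> bool" where
  line: "finite H \<Longrightarrow> H \<subseteq> coord_space 1 \<Longrightarrow> horton 1 H"
| small: "2 \<le> d \<Longrightarrow> strongly_general_position d H \<Longrightarrow> card H \<le> 1 \<Longrightarrow> horton d H"
| split: "2 \<le> d \<Longrightarrow> strongly_general_position d H \<Longrightarrow>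
    (2 < d \<longrightarrow> horton (d - 1) (first_coords (d - 1) ` H)) \<Longrightarrow>
    (\<forall>i<horton_prime d. horton d (residue_part H i (horton_prime d))) \<Longrightarrow>
    (\<forall>I\<subseteq>{..<horton_prime d}. 2 \<le> card I \<longrightarrow>
       (\<exists>J\<subseteq>I. J \<noteq> {} \<and> I - J \<noteq> {} \<and>
          deep_below d (\<Union>j\<in>J. residue_part H j (horton_prime d))
                       (\<Union>i\<in>I - J. residue_part H i (horton_prime d)))) \<Longrightarrow>
    horton d H"

definition is_island :: "point set \<Rightarrow> nat \<Rightarrow> point set \<Rightarrow> bool" where
  "is_island S k I \<longleftrightarrow> I \<subseteq> S \<and> card I = k \<and> (convex hull I) \<inter> S = I"

definition convex_position :: "point set \<Rightarrow> bool" where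
  "convex_position I \<longleftrightarrow> (\<forall>x\<in>I. x \<notin> convex hull (I - {x}))"

definition is_hole :: "point set \<Rightarrow> nat \<Rightarrow> point set \<Rightarrow> bool" where
  "is_hole S k I \<longleftrightarrow> is_island S k I \<and> convex_position I"

end

theory Submission
  imports Defs
begin

text \<open>Splitting the residue classes mod \<open>p\<^sub>d\<close> of a \<open>d\<close>-Horton set \<open>H\<close> recursively leads to two
  classes \<open>A\<close> and \<open>B\<close> such that \<open>B\<close> is deep below \<open>A\<close> and every other class is deep above or deep
  below \<open>A \<union> B\<close>. If the projections of \<open>E \<subseteq> A\<close> and \<open>F \<subseteq> B\<close> are islands (holes) in the
  projections of \<open>A\<close> and \<open>B\<close>, then \<open>E \<union> F\<close> is an island (a hole) in \<open>H\<close>: a hyperplane through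
  \<open>x \<in> A\<close> that has \<open>E\<close> on or below it can be rotated about \<open>x\<close> until it passes through \<open>d\<close> points
  of \<open>A\<close>; it then lies above all of \<open>B\<close>, and a small perturbation separates \<open>x\<close> from \<open>E \<union> F\<close>.
  Splitting \<open>k\<close> into halves thus doubles the exponent with each dimension, starting from runs of
  consecutive points in the plane. A run of three points of \<open>A\<close> (of \<open>B\<close>) has to be a cap (a cup) if
  holes are wanted, which holds for every other run.\<close>

section \<open>Coordinates and general position\<close>

abbreviation unit_vec :: "nat \<Rightarrow> point" where
  "unit_vec i \<equiv> Poly_Mapping.single i 1"

abbreviation coord :: "nat \<Rightarrow> point \<Rightarrow> real" where
  "coord i x \<equiv> Poly_Mapping.lookup x i"

lemma coord_scaleR [simp]: "coord i (r *\<^sub>R x) = r * coord i x"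
proof -
  have "finite {i. r * coord i x \<noteq> 0}"
    by (rule finite_subset[OF _ finite_keys[of x]]) (auto simp: in_keys_iff)
  then show ?thesis
    by (simp add: scaleR_poly_mapping_def Abs_poly_mapping_inverse)
qed

lemma linear_coord: "linear (coord i)"
  by (rule linearI) (simp_all add: lookup_add)

lemma coord_first_coords: "coord i (first_coords m x) = (if i < m then coord i x else 0)"
  by (simp add: first_coords_def lookup_sum lookup_single when_def)

lemma linear_first_coords: "linear (first_coords m)"
  by (rule linearI) (auto intro!: poly_mapping_eqI simp: coord_first_coords lookup_add)

lemma first_coords_unit_vec: "m \<le> i \<Longrightarrow> first_coords m (unit_vec i) = 0"
  by (rule poly_mapping_eqI) (auto simp: coord_first_coords lookup_single)

lemma inj_on_first_coords:
  assumes "inj_on (coord 0) A" "0 < m"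
  shows "inj_on (first_coords m) A"
proof (rule inj_on_imageI2)
  have "coord 0 \<circ> first_coords m = coord 0"
    using assms(2) by (auto simp: coord_first_coords)
  then show "inj_on (coord 0 \<circ> first_coords m) A"
    using assms(1) by simp
qed

lemma mem_coord_space: "x \<in> coord_space d \<longleftrightarrow> (\<forall>i\<ge>d. coord i x = 0)"
  by (auto simp: coord_space_def in_keys_iff subset_iff not_less[symmetric])

lemma subspace_coord_space: "subspace (coord_space d)"
  by (auto simp: subspace_def mem_coord_space lookup_add)

lemma affine_hull_subset_coord_space: "T \<subseteq> coord_space d \<Longrightarrow> affine hull T \<subseteq> coord_space d"
  by (intro hull_minimal subspace_imp_affine subspace_coord_space)

lemma diff_eq_scaleR_unit_vec:
  assumes "x \<in> coord_space d" "y \<in> coord_space d" "1 \<le> d"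
    and eq: "first_coords (d - 1) x = first_coords (d - 1) y"
  shows "x - y = (coord (d - 1) x - coord (d - 1) y) *\<^sub>R unit_vec (d - 1)"
proof (rule poly_mapping_eqI)
  fix i
  have "coord i x = coord i y" if "i < d - 1"
    using that arg_cong[OF eq, of "coord i"] by (simp add: coord_first_coords)
  moreover have "coord i x = coord i y" if "d \<le> i"
    using that assms(1,2) by (simp add: mem_coord_space)
  ultimately show "coord i (x - y) =
      coord i ((coord (d - 1) x - coord (d - 1) y) *\<^sub>R unit_vec (d - 1))"
    using \<open>1 \<le> d\<close> by (cases i "d - 1" rule: linorder_cases) (auto simp: lookup_minus lookup_single)
qed

lemma mem_last_axes_space:
  assumes x: "x \<in> coord_space d" "\<forall>i<d - m. coord i x = 0"
  shows "x \<in> last_axes_space d m"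
proof -
  have "x = (\<Sum>i\<in>{d - m..<d}. coord i x *\<^sub>R unit_vec i)"
  proof (rule poly_mapping_eqI)
    fix j
    have "coord j x = 0" if "j \<notin> {d - m..<d}"
      using that x by (auto simp: mem_coord_space)
    then show "coord j x = coord j (\<Sum>i\<in>{d - m..<d}. coord i x *\<^sub>R unit_vec i)"
      by (simp add: lookup_sum lookup_single when_def if_distrib cong: if_cong)
  qed
  also have "\<dots> \<in> last_axes_space d m"
    unfolding last_axes_space_def by (intro span_sum span_scale span_base) auto
  finally show ?thesis .
qed

lemma direction_translation_subspace:
  assumes W: "subspace W"
  shows "direction ((+) a ` W) = W"
proof (intro subset_antisym subsetI)
  fix x assume "x \<in> direction ((+) a ` W)"
  then obtain u v where "x = (a + u) - (a + v)" "u \<in> W" "v \<in> W"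
    unfolding direction_def by blast
  then show "x \<in> W" using W by (simp add: subspace_diff)
next
  fix x assume "x \<in> W"
  moreover have "x = (a + x) - (a + 0)" by simp
  ultimately show "x \<in> direction ((+) a ` W)"
    unfolding direction_def using subspace_0[OF W] by blast
qed

lemma direction_last_axes_space: "direction (last_axes_space d m) = last_axes_space d m"
  using direction_translation_subspace[of "last_axes_space d m" 0]
  by (simp add: last_axes_space_def)

lemma direction_affine_hull:
  "a \<in> S \<Longrightarrow> direction (affine hull S) = span ((\<lambda>x. - a + x) ` (S - {a}))"
  by (simp add: affine_hull_span2 direction_translation_subspace)

lemma affine_subspace_affine_hull:
  assumes T: "T \<subseteq> coord_space d" "\<not> affine_dependent T" "card T = Suc i"
  shows "affine_subspace d i (affine hull T)"
proof -
  obtain a where a: "a \<in> T" using T(3) by fastforce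
  let ?V = "(\<lambda>x. - a + x) ` (T - {a})"
  have "independent ?V" using a T(2) by (simp add: affine_dependent_iff_dependent2)
  moreover have "card ?V = i"
    using a T(3) by (subst card_image) (auto simp: inj_on_def card_Diff_singleton)
  ultimately have "dim (direction (affine hull T)) = i"
    using a by (simp add: direction_affine_hull dim_eq_card_independent)
  then show ?thesis
    using a affine_hull_subset_coord_space[OF T(1)] by (auto simp: affine_subspace_def)
qed

text \<open>A minimal affinely dependent set of \<open>i + 2\<close> points spans an affine subspace of dimension \<open>i\<close>.\<close>

lemma general_position_affine_independent:
  assumes gp: "general_position d S" and T: "T \<subseteq> S" "card T \<le> d + 1"
  shows "\<not> affine_dependent T"
proof -
  have "finite T" using gp T(1) by (auto simp: general_position_def intro: finite_subset)
  then show ?thesis using T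
  proof (induction T rule: finite_psubset_induct)
    case (psubset T)
    show ?case
    proof
      assume "affine_dependent T"
      then obtain x where x: "x \<in> T" "x \<in> affine hull (T - {x})"
        unfolding affine_dependent_def by blast
      have "card T \<noteq> 0" "card T \<noteq> 1" "card T \<noteq> 2"
        using \<open>affine_dependent T\<close> psubset.hyps by (auto simp: card_1_singleton_iff card_2_iff)
      then obtain i where i: "card T = i + 2" "i \<in> {1..d - 1}"
        using psubset.prems(2) by (intro that[of "card T - 2"]) auto
      have "\<not> affine_dependent (T - {x})"
        using psubset.IH[of "T - {x}"] psubset.prems psubset.hyps x(1) i(1) by auto
      then have "affine_subspace d i (affine hull (T - {x}))"
        using gp psubset.prems(1) x(1) i(1)
        by (intro affine_subspace_affine_hull) (auto simp: general_position_def)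
      moreover have "T \<subseteq> affine hull (T - {x})"
        using x by (metis hull_redundant hull_subset insert_Diff)
      ultimately show False
        using gp psubset.prems(1) i unfolding general_position_def by blast
    qed
  qed
qed

lemma general_position_affine_subspace:
  assumes "general_position d S" "T \<subseteq> S" "card T = Suc i" "i \<le> d"
  shows "affine_subspace d i (affine hull T)"
  using assms general_position_affine_independent[OF assms(1,2)]
  by (intro affine_subspace_affine_hull) (auto simp: general_position_def)

lemma strongly_general_position_subset:
  assumes "strongly_general_position d S" "S' \<subseteq> S"
  shows "strongly_general_position d S'"
  using assms subset_trans[OF _ assms(2)] finite_subset[OF assms(2)]
  unfolding strongly_general_position_def general_position_def by (meson subset_trans)

lemma strongly_general_position_finite: "strongly_general_position d S \<Longrightarrow> finite S"
  by (simp add: strongly_general_position_def general_position_def)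

lemma strongly_general_position_coord_space:
  "strongly_general_position d S \<Longrightarrow> S \<subseteq> coord_space d"
  by (simp add: strongly_general_position_def general_position_def)

lemma strongly_general_position_not_parallel:
  assumes sgp: "strongly_general_position d S"
    and T: "T \<subseteq> S" "card T = i + 1" and i: "i \<in> {1..d - 1}"
  shows "\<not> last_axes_space d (d - i) \<subseteq> direction (affine hull T)"
    and "\<not> direction (affine hull T) \<subseteq> last_axes_space d (d - i)"
proof -
  have "affine_subspace d i (affine hull T)"
    using sgp T i
    by (intro general_position_affine_subspace) (auto simp: strongly_general_position_def)
  then have "\<not> parallel_subspaces (affine hull T) (last_axes_space d (d - i))"
    using sgp T i unfolding strongly_general_position_def by blast
  then show "\<not> last_axes_space d (d - i) \<subseteq> direction (affine hull T)"
    and "\<not> direction (affine hull T) \<subseteq> last_axes_space d (d - i)"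
    by (simp_all add: parallel_subspaces_def direction_last_axes_space)
qed

lemma strongly_general_position_inj_on_first_coord:
  assumes sgp: "strongly_general_position d S" and d: "2 \<le> d"
  shows "inj_on (coord 0) S"
proof (rule inj_onI, rule ccontr)
  fix x y assume xy: "x \<in> S" "y \<in> S" "coord 0 x = coord 0 y" "x \<noteq> y"
  have "y - x \<in> coord_space d"
    using strongly_general_position_coord_space[OF sgp] xy
    by (intro subspace_diff subspace_coord_space) auto
  then have "y - x \<in> last_axes_space d (d - 1)"
    using xy d by (intro mem_last_axes_space) (auto simp: lookup_minus)
  then have "span {y - x} \<subseteq> last_axes_space d (d - 1)"
    by (intro span_minimal) (auto simp: last_axes_space_def)
  moreover have "direction (affine hull {x, y}) = span {y - x}"
    using direction_affine_hull[of x "{x, y}"] xy(4) by (simp add: insert_Diff_if)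
  moreover have "1 \<in> {1..d - 1}" using d by auto
  ultimately show False
    using strongly_general_position_not_parallel(2)[OF sgp, of "{x, y}" 1] xy by auto
qed

section \<open>Affine forms\<close>

text \<open>For \<open>s \<noteq> 0\<close>, the zero sets of these functions are the nonvertical hyperplanes.\<close>

definition affine_forms :: "nat \<Rightarrow> real \<Rightarrow> (point \<Rightarrow> real) set" where
  "affine_forms d s =
     {\<phi>. \<exists>f c. linear f \<and> f (unit_vec (d - 1)) = s \<and> \<phi> = (\<lambda>x. f x + c)}"

lemma affine_formsE:
  assumes "\<phi> \<in> affine_forms d s"
  obtains f c where "linear f" "f (unit_vec (d - 1)) = s" "\<phi> = (\<lambda>x. f x + c)"
  using assms unfolding affine_forms_def by blast

lemma linear_affine_form: "linear f \<Longrightarrow> f (unit_vec (d - 1)) = s \<Longrightarrow> f \<in> affine_forms d s"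
  unfolding affine_forms_def by (auto intro!: exI[of _ f] exI[of _ 0])

lemma affine_forms_add_scale:
  assumes "\<phi> \<in> affine_forms d s" "\<psi> \<in> affine_forms d t"
  shows "(\<lambda>x. \<phi> x + r * \<psi> x) \<in> affine_forms d (s + r * t)"
proof -
  obtain f c where f: "linear f" "f (unit_vec (d - 1)) = s" "\<phi> = (\<lambda>x. f x + c)"
    using assms(1) by (rule affine_formsE)
  obtain g b where g: "linear g" "g (unit_vec (d - 1)) = t" "\<psi> = (\<lambda>x. g x + b)"
    using assms(2) by (rule affine_formsE)
  have "linear (\<lambda>x. f x + r *\<^sub>R g x)"
    using f(1) g(1) by (intro linear_compose_add linear_compose_scale_right)
  then show ?thesis
    unfolding affine_forms_def using f g
    by (auto intro!: exI[of _ "\<lambda>x. f x + r *\<^sub>R g x"] exI[of _ "c + r * b"] simp: algebra_simps)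
qed

lemma affine_forms_add_const:
  "\<phi> \<in> affine_forms d s \<Longrightarrow> (\<lambda>x. \<phi> x + c) \<in> affine_forms d s"
  by (erule affine_formsE) (auto simp: affine_forms_def add.assoc)

lemma affine_forms_scale_last_coord: "(\<lambda>x. s * coord (d - 1) x) \<in> affine_forms d s"
  using linear_compose_scale_right[OF linear_coord, of s]
  by (intro linear_affine_form) (simp_all add: lookup_single)

lemma affine_form_eq_0_on_affine_hull:
  assumes "\<phi> \<in> affine_forms d s" "\<forall>t\<in>T. \<phi> t = 0" "y \<in> affine hull T"
  shows "\<phi> y = 0"
proof -
  obtain f c where f: "linear f" "\<phi> = (\<lambda>x. f x + c)"
    using assms(1) by (rule affine_formsE)
  have "u * f x + v * f z + c = u * (f x + c) + v * (f z + c)" if "u + v = 1" for u v x z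
  proof -
    have "u * (f x + c) + v * (f z + c) = u * f x + v * f z + (u + v) * c"
      by (simp add: algebra_simps)
    then show ?thesis using that by simp
  qed
  then have "affine {y. \<phi> y = 0}"
    unfolding affine_def f(2) by (simp add: linear_add[OF f(1)] linear_scale[OF f(1)])
  then have "affine hull T \<subseteq> {y. \<phi> y = 0}"
    using assms(2) by (intro hull_minimal) auto
  then show ?thesis using assms(3) by auto
qed

lemma affine_form_diff_vertical:
  assumes "\<phi> \<in> affine_forms d s" "x \<in> coord_space d" "y \<in> coord_space d" "1 \<le> d"
    and "first_coords (d - 1) x = first_coords (d - 1) y"
  shows "\<phi> x - \<phi> y = s * (coord (d - 1) x - coord (d - 1) y)"
proof -
  obtain f c where f: "linear f" "f (unit_vec (d - 1)) = s" "\<phi> = (\<lambda>x. f x + c)"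
    using assms(1) by (rule affine_formsE)
  have "\<phi> x - \<phi> y = f (x - y)" by (simp add: f(3) linear_diff[OF f(1)])
  also have "\<dots> = (coord (d - 1) x - coord (d - 1) y) * s"
    unfolding diff_eq_scaleR_unit_vec[OF assms(2-)] linear_scale[OF f(1)] f(2) by simp
  finally show ?thesis by (simp add: mult.commute)
qed

lemma affine_independent_interpolation:
  fixes v :: "point \<Rightarrow> real"
  assumes T: "\<not> affine_dependent T" "T \<noteq> {}" and e: "e \<notin> direction (affine hull T)"
  shows "\<exists>f c. linear f \<and> f e = s \<and> (\<forall>t\<in>T. f t + c = v t)"
proof -
  obtain a where a: "a \<in> T" using T(2) by blast
  let ?V = "(\<lambda>x. - a + x) ` (T - {a})"
  have not_span: "e \<notin> span ?V" using e by (simp add: direction_affine_hull[OF a])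
  have "independent (insert e ?V)"
    using not_span T(1) a by (intro independent_insertI) (simp_all add: affine_dependent_iff_dependent2)
  then obtain f :: "point \<Rightarrow> real" where f: "linear f"
    "\<forall>x\<in>insert e ?V. f x = (if x = e then s else v (a + x) - v a)"
    using linear_independent_extend[of _ "\<lambda>x. if x = e then s else v (a + x) - v a"] by blast
  have "f t + (v a - f a) = v t" if "t \<in> T" for t
  proof (cases "t = a")
    case False
    then have V: "- a + t \<in> ?V" using that by blast
    then have "- a + t \<noteq> e" using not_span span_base[OF V] by metis
    then have "f (- a + t) = v t - v a"
      using f(2)[rule_format, OF insertI2, OF V] by simp
    then show ?thesis by (simp add: linear_diff[OF f(1)])
  qed simp
  then show ?thesis using f by (intro exI[of _ f] exI[of _ "v a - f a"]) simp
qed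

lemma strongly_general_position_interpolation:
  assumes sgp: "strongly_general_position d S" and d: "2 \<le> d" and T: "T \<subseteq> S" "card T = d"
  shows "\<exists>\<phi>\<in>affine_forms d s. \<forall>t\<in>T. \<phi> t = v t"
proof -
  obtain a where a: "a \<in> T" using T(2) d by fastforce
  have "{unit_vec j |j. d - (d - (d - 1)) \<le> j \<and> j < d} = {unit_vec (d - 1)}"
    using d by (auto intro!: exI[of _ "d - 1"] arg_cong[of _ _ unit_vec])
  then have "last_axes_space d (d - (d - 1)) = span {unit_vec (d - 1)}"
    by (simp only: last_axes_space_def)
  moreover have "\<not> last_axes_space d (d - (d - 1)) \<subseteq> direction (affine hull T)"
    using sgp T d by (intro strongly_general_position_not_parallel(1)) auto
  moreover have "subspace (direction (affine hull T))"
    by (simp add: direction_affine_hull[OF a])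
  ultimately have "unit_vec (d - 1) \<notin> direction (affine hull T)"
    by (metis empty_subsetI insert_subset span_minimal)
  moreover have "\<not> affine_dependent T"
    using sgp T unfolding strongly_general_position_def
    by (intro general_position_affine_independent) auto
  ultimately obtain f c where "linear f" "f (unit_vec (d - 1)) = s" "\<forall>t\<in>T. f t + c = v t"
    using affine_independent_interpolation[of T "unit_vec (d - 1)" s v] a by blast
  then show ?thesis
    unfolding affine_forms_def by (intro bexI[of _ "\<lambda>x. f x + c"]) auto
qed

section \<open>Rotating hyperplanes\<close>

definition supporting_forms :: "nat \<Rightarrow> real \<Rightarrow> point set \<Rightarrow> point set \<Rightarrow> (point \<Rightarrow> real) set" where
  "supporting_forms d s E T = {\<phi> \<in> affine_forms d s. (\<forall>x\<in>E. \<phi> x \<le> 0) \<and> (\<forall>t\<in>T. \<phi> t = 0)}"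

text \<open>This is the pivoting rule of the simplex method.\<close>

lemma ratio_test:
  fixes \<phi> h :: "'a \<Rightarrow> real"
  assumes E: "finite E" "\<forall>x\<in>E. \<phi> x \<le> 0" and e: "e \<in> E" "0 < h e"
  shows "\<exists>r. \<exists>y\<in>E. 0 < h y \<and> \<phi> y + r * h y = 0 \<and> (\<forall>x\<in>E. \<phi> x + r * h x \<le> 0)"
proof -
  let ?q = "\<lambda>x. - \<phi> x / h x"
  define y where "y = arg_min_on ?q {x \<in> E. 0 < h x}"
  have P: "finite {x \<in> E. 0 < h x}" "{x \<in> E. 0 < h x} \<noteq> {}" using E(1) e by auto
  have y: "y \<in> E" "0 < h y"
    using arg_min_if_finite(1)[OF P, of ?q] by (simp_all add: y_def)
  have min: "?q y \<le> ?q x" if "x \<in> E" "0 < h x" for x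
    using arg_min_least[OF P, of x ?q] that by (simp add: y_def)
  have "\<phi> x + ?q y * h x \<le> 0" if x: "x \<in> E" for x
  proof (cases "0 < h x")
    case True
    then show ?thesis using min[OF x True] by (simp add: pos_divide_le_eq)
  next
    case False
    moreover have "0 \<le> ?q y" using y E(2) by (simp add: divide_nonpos_pos)
    ultimately have "?q y * h x \<le> 0" by (intro mult_nonneg_nonpos) auto
    then show ?thesis using E(2) x by fastforce
  qed
  then show ?thesis using y by (intro exI[of _ "?q y"] bexI[of _ y]) auto
qed

lemma supporting_forms_insert:
  assumes A: "strongly_general_position d A" "2 \<le> d" "d \<le> card A" and E: "E \<subseteq> A"
    and T: "T \<subseteq> A" "card T < d" "\<phi> \<in> supporting_forms d s E T" and e: "e \<in> E - T"
  shows "\<exists>y\<in>E - T. \<exists>\<psi>. \<psi> \<in> supporting_forms d s E (insert y T)"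
proof -
  have fin: "finite A" using A(1) by (rule strongly_general_position_finite)
  have \<phi>: "\<phi> \<in> affine_forms d s" "\<forall>x\<in>E. \<phi> x \<le> 0" "\<forall>t\<in>T. \<phi> t = 0"
    using T(3) by (auto simp: supporting_forms_def)
  have "card (insert e T) \<le> d" "insert e T \<subseteq> A"
    using T e E fin by (auto simp: card_insert_if finite_subset)
  then obtain U where U: "insert e T \<subseteq> U" "U \<subseteq> A" "card U = d"
    using exists_subset_between[of "insert e T" d A] A(3) fin by auto
  obtain h where h: "h \<in> affine_forms d 0" "\<forall>t\<in>U. h t = of_bool (t = e)"
    using strongly_general_position_interpolation[OF A(1,2) U(2,3), of 0 "\<lambda>t. of_bool (t = e)"]
    by blast
  obtain r y where y: "y \<in> E" "0 < h y" "\<phi> y + r * h y = 0" "\<forall>x\<in>E. \<phi> x + r * h x \<le> 0"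
    using ratio_test[of E \<phi> e h] finite_subset[OF E fin] \<phi>(2) e h(2) U(1) by auto
  have h0: "\<forall>t\<in>T. h t = 0" using h(2) U(1) e by auto
  have "(\<lambda>x. \<phi> x + r * h x) \<in> supporting_forms d s E (insert y T)"
    using affine_forms_add_scale[OF \<phi>(1) h(1), of r] \<phi>(3) h0 y(3,4)
    by (simp add: supporting_forms_def)
  moreover have "y \<notin> T" using y(2) h0 by auto
  ultimately show ?thesis using y(1) by blast
qed

lemma supporting_forms_extend:
  assumes A: "strongly_general_position d A" "2 \<le> d" "d \<le> card A" and E: "E \<subseteq> A"
    and T: "T \<subseteq> A" "card T \<le> d" "\<phi> \<in> supporting_forms d s E T"
  shows "\<exists>U \<psi>. T \<subseteq> U \<and> U \<subseteq> A \<and> card U = d \<and> \<psi> \<in> supporting_forms d s E U"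
  using T
proof (induction "d - card T" arbitrary: T \<phi> rule: less_induct)
  case less
  have fin: "finite A" using A(1) by (rule strongly_general_position_finite)
  consider "card T = d" | "E \<subseteq> T" | e where "card T < d" "e \<in> E - T"
    using less.prems(2) by fastforce
  then show ?case
  proof cases
    case 1
    then show ?thesis using less.prems by blast
  next
    case 2
    obtain U where U: "T \<subseteq> U" "U \<subseteq> A" "card U = d"
      using exists_subset_between[of T d A] less.prems A(3) fin by auto
    obtain \<psi> where "\<psi> \<in> affine_forms d s" "\<forall>t\<in>U. \<psi> t = 0"
      using strongly_general_position_interpolation[OF A(1,2) U(2,3), of s "\<lambda>_. 0"] by blast
    then have "\<psi> \<in> supporting_forms d s E U"
      using 2 U(1) by (auto simp: supporting_forms_def subset_iff)
    then show ?thesis using U by blast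
  next
    case 3
    obtain y \<psi> where y: "y \<in> E - T" "\<psi> \<in> supporting_forms d s E (insert y T)"
      using supporting_forms_insert[OF A E less.prems(1) 3(1) less.prems(3) 3(2)] by blast
    have "card (insert y T) = Suc (card T)"
      using y(1) less.prems(1) fin by (simp add: finite_subset)
    then have "\<exists>U \<psi>. insert y T \<subseteq> U \<and> U \<subseteq> A \<and> card U = d \<and> \<psi> \<in> supporting_forms d s E U"
      using less.prems(1) y E 3(1) by (intro less.hyps[OF _ _ _ y(2)]) auto
    then show ?thesis by blast
  qed
qed

section \<open>Separation\<close>

definition linearly_separated :: "'a::real_vector \<Rightarrow> 'a set \<Rightarrow> bool" where
  "linearly_separated x G \<longleftrightarrow> (\<exists>f :: 'a \<Rightarrow> real. linear f \<and> (\<forall>g\<in>G. f g < f x))"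

definition slope_separated :: "nat \<Rightarrow> real \<Rightarrow> point \<Rightarrow> point set \<Rightarrow> bool" where
  "slope_separated d s x G \<longleftrightarrow> (\<exists>\<phi>\<in>affine_forms d s. \<forall>g\<in>G. \<phi> g < \<phi> x)"

text \<open>\<open>B\<close> lies below (\<open>s = 1\<close>) or above (\<open>s = - 1\<close>) every hyperplane through \<open>d\<close> points of \<open>A\<close>.\<close>

definition beyond :: "nat \<Rightarrow> real \<Rightarrow> point set \<Rightarrow> point set \<Rightarrow> bool" where
  "beyond d s A B \<longleftrightarrow>
     (\<forall>T\<subseteq>A. card T = d \<longrightarrow>
        (\<forall>\<phi>\<in>affine_forms d s. (\<forall>t\<in>T. \<phi> t = 0) \<longrightarrow> (\<forall>b\<in>B. \<phi> b < 0)))"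

lemma beyondD:
  "\<lbrakk>beyond d s A B; T \<subseteq> A; card T = d; \<phi> \<in> affine_forms d s; \<forall>t\<in>T. \<phi> t = 0; b \<in> B\<rbrakk>
    \<Longrightarrow> \<phi> b < 0"
  unfolding beyond_def by blast

lemma beyond_mono: "beyond d s A B \<Longrightarrow> B' \<subseteq> B \<Longrightarrow> beyond d s A B'"
  unfolding beyond_def by blast

lemma linearly_separated_not_in_convex_hull:
  assumes "linearly_separated x G"
  shows "x \<notin> convex hull G"
proof
  assume x: "x \<in> convex hull G"
  obtain f :: "'a \<Rightarrow> real" where f: "linear f" "\<forall>g\<in>G. f g < f x"
    using assms unfolding linearly_separated_def by blast
  have "convex {y. f y < f x}"
    using convex_linear_vimage[OF f(1) convex_real_interval(4), of "f x"]
    by (simp add: vimage_def lessThan_def)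
  then have "convex hull G \<subseteq> {y. f y < f x}" using f(2) by (intro hull_minimal) auto
  then show False using x by auto
qed

lemma slope_separated_imp_linearly_separated:
  "slope_separated d s x G \<Longrightarrow> linearly_separated x G"
  unfolding slope_separated_def linearly_separated_def by (auto elim!: affine_formsE)

lemma exists_small_multiplier:
  fixes g h :: "'a \<Rightarrow> real"
  assumes "finite F" "\<forall>x\<in>F. 0 < g x"
  shows "\<exists>\<epsilon>>0. \<forall>x\<in>F. \<epsilon> * h x < g x"
proof -
  have "\<forall>\<^sub>F \<epsilon> in at_right 0. \<epsilon> * h x < g x" if "x \<in> F" for x
  proof (rule order_tendstoD(2))
    show "((\<lambda>\<epsilon>. \<epsilon> * h x) \<longlongrightarrow> 0) (at_right 0)"
      by (rule tendsto_eq_intros | simp)+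
  qed (use assms(2) that in auto)
  then have "\<forall>\<^sub>F \<epsilon> in at_right 0. \<epsilon> > 0 \<and> (\<forall>x\<in>F. \<epsilon> * h x < g x)"
    using assms(1) by (intro eventually_conj eventually_at_right_less eventually_ball_finite) auto
  then show ?thesis by (auto dest: eventually_happens)
qed

lemma slope_separated_if_vertically_separated:
  assumes "slope_separated d 0 x G" and G: "finite G"
  shows "slope_separated d s x G"
proof -
  obtain \<phi> where \<phi>: "\<phi> \<in> affine_forms d 0" "\<forall>g\<in>G. \<phi> g < \<phi> x"
    using assms(1) unfolding slope_separated_def by blast
  let ?z = "\<lambda>y. s * coord (d - 1) y"
  obtain \<epsilon> where \<epsilon>: "\<epsilon> > 0" "\<forall>g\<in>G. \<epsilon> * (?z g - ?z x) < \<phi> x - \<phi> g"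
    using exists_small_multiplier[OF G, of "\<lambda>g. \<phi> x - \<phi> g" "\<lambda>g. ?z g - ?z x"] \<phi>(2) by auto
  have "?z g + (1 / \<epsilon>) * \<phi> g < ?z x + (1 / \<epsilon>) * \<phi> x" if "g \<in> G" for g
  proof -
    have "?z g - ?z x < (\<phi> x - \<phi> g) / \<epsilon>"
      using \<epsilon> that by (simp add: pos_less_divide_eq mult.commute)
    then show ?thesis by (simp add: diff_divide_distrib)
  qed
  moreover have "(\<lambda>y. ?z y + (1 / \<epsilon>) * \<phi> y) \<in> affine_forms d s"
    using affine_forms_add_scale[OF affine_forms_scale_last_coord \<phi>(1), of s "1 / \<epsilon>"] by simp
  ultimately show ?thesis
    unfolding slope_separated_def by (intro bexI[of _ "\<lambda>y. ?z y + (1 / \<epsilon>) * \<phi> y"]) auto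
qed

lemma slope_separated_if_projection_separated:
  assumes sep: "linearly_separated (first_coords (d - 1) x) (first_coords (d - 1) ` G)"
    and G: "finite G"
  shows "slope_separated d s x G"
proof -
  obtain f :: "point \<Rightarrow> real" where f: "linear f"
    "\<forall>g\<in>G. f (first_coords (d - 1) g) < f (first_coords (d - 1) x)"
    using sep unfolding linearly_separated_def by blast
  have "f \<circ> first_coords (d - 1) \<in> affine_forms d 0"
    using linear_compose[OF linear_first_coords f(1)] linear_0[OF f(1)]
    by (intro linear_affine_form) (simp_all add: first_coords_unit_vec)
  then have "slope_separated d 0 x G"
    unfolding slope_separated_def using f(2) by (intro bexI[of _ "f \<circ> first_coords (d - 1)"]) auto
  then show ?thesis using G by (rule slope_separated_if_vertically_separated)
qed

lemma slope_separated_if_extreme_first_coord: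
  assumes d: "2 \<le> d" and G: "finite G"
    and extreme: "(\<forall>g\<in>G. coord 0 g < coord 0 x) \<or> (\<forall>g\<in>G. coord 0 x < coord 0 g)"
  shows "slope_separated d s x G"
proof (rule slope_separated_if_vertically_separated[OF _ G])
  have "coord 0 \<in> affine_forms d 0" "(\<lambda>y. - coord 0 y) \<in> affine_forms d 0"
    using d linear_coord by (auto intro!: linear_affine_form linear_compose_neg simp: lookup_single)
  then show "slope_separated d 0 x G"
    unfolding slope_separated_def using extreme
    by (elim disjE) (force intro: bexI[of _ "coord 0"] bexI[of _ "\<lambda>y. - coord 0 y"])+
qed

lemma slope_separated_if_beyond:
  assumes A: "strongly_general_position d A" "2 \<le> d" "d \<le> card A" and D: "D \<subseteq> A"
    and x: "beyond d s A {x}"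
  shows "slope_separated d (- s) x D"
proof -
  let ?z = "\<lambda>y. - s * coord (d - 1) y"
  have "finite (?z ` D)"
    using strongly_general_position_finite[OF A(1)] D by (simp add: finite_subset)
  then obtain c where c: "\<forall>y\<in>D. ?z y \<le> c" by (meson bdd_above_finite bdd_above.unfold imageI)
  have supp: "(\<lambda>y. ?z y + - c) \<in> supporting_forms d (- s) D {}"
    using c affine_forms_add_const[OF affine_forms_scale_last_coord, of "- s" d "- c"]
    by (simp add: supporting_forms_def)
  then obtain T \<psi> where T: "T \<subseteq> A" "card T = d" "\<psi> \<in> affine_forms d (- s)"
    "\<forall>y\<in>D. \<psi> y \<le> 0" "\<forall>t\<in>T. \<psi> t = 0"
    using supporting_forms_extend[OF A D _ _ supp] unfolding supporting_forms_def by auto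
  have neg: "(\<lambda>y. - \<psi> y) \<in> affine_forms d s"
    using affine_forms_add_scale[OF affine_forms_scale_last_coord T(3), of 0 "- 1"] by simp
  have "- \<psi> x < 0" using beyondD[OF x T(1,2) neg] T(5) by simp
  then show ?thesis
    unfolding slope_separated_def using T(3,4) by (intro bexI[of _ \<psi>]) (auto intro: le_less_trans)
qed

lemma linearly_separated_union_if_beyond:
  assumes A: "strongly_general_position d A" "2 \<le> d" "d \<le> card A"
    and x: "x \<in> A" and E: "E \<subseteq> A" "slope_separated d s x E"
    and F: "beyond d s A F" "finite F"
  shows "linearly_separated x (E \<union> F)"
proof -
  obtain \<phi> where \<phi>: "\<phi> \<in> affine_forms d s" "\<forall>g\<in>E. \<phi> g < \<phi> x"
    using E(2) unfolding slope_separated_def by blast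
  have supp: "(\<lambda>y. \<phi> y + - \<phi> x) \<in> supporting_forms d s E {x}"
    using affine_forms_add_const[OF \<phi>(1), of "- \<phi> x"] \<phi>(2) by (auto simp: supporting_forms_def)
  then obtain T \<psi> where T: "x \<in> T" "T \<subseteq> A" "card T = d" "\<psi> \<in> affine_forms d s"
    "\<forall>e\<in>E. \<psi> e \<le> 0" "\<forall>t\<in>T. \<psi> t = 0"
    using supporting_forms_extend[OF A E(1) _ _ supp] x A(2) unfolding supporting_forms_def by auto
  have "\<forall>b\<in>F. 0 < - \<psi> b" using beyondD[OF F(1) T(2-4,6)] by simp
  then obtain \<epsilon> where \<epsilon>: "\<epsilon> > 0" "\<forall>b\<in>F. \<epsilon> * (\<phi> b - \<phi> x) < - \<psi> b"
    using exists_small_multiplier[OF F(2), of "\<lambda>b. - \<psi> b" "\<lambda>b. \<phi> b - \<phi> x"] by auto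
  have "\<psi> g + \<epsilon> * \<phi> g < \<psi> x + \<epsilon> * \<phi> x" if "g \<in> E \<union> F" for g
  proof (cases "g \<in> E")
    case True
    then have "\<epsilon> * \<phi> g < \<epsilon> * \<phi> x" "\<psi> g \<le> 0" using \<phi>(2) \<epsilon>(1) T(5) by auto
    then show ?thesis using T(1,6) by simp
  next
    case False
    then have "\<epsilon> * (\<phi> g - \<phi> x) < - \<psi> g" using that \<epsilon>(2) by blast
    then show ?thesis using T(1,6) by (simp add: algebra_simps)
  qed
  then have "slope_separated d (s + \<epsilon> * s) x (E \<union> F)"
    unfolding slope_separated_def
    using affine_forms_add_scale[OF T(4) \<phi>(1), of \<epsilon>]
    by (intro bexI[of _ "\<lambda>y. \<psi> y + \<epsilon> * \<phi> y"]) auto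
  then show ?thesis by (rule slope_separated_imp_linearly_separated)
qed

lemma affine_form_eq_height_over_hyperplane:
  assumes \<phi>: "\<phi> \<in> affine_forms d s" "\<forall>t\<in>T. \<phi> t = 0" and T: "T \<subseteq> coord_space d"
    and x: "x \<in> coord_space d" and d: "1 \<le> d"
    and y: "y \<in> affine hull T" "first_coords (d - 1) y = first_coords (d - 1) x"
  shows "\<phi> x = s * (coord (d - 1) x - coord (d - 1) y)"
proof -
  have "\<phi> y = 0" using \<phi> y(1) by (rule affine_form_eq_0_on_affine_hull)
  moreover have "y \<in> coord_space d" using affine_hull_subset_coord_space[OF T] y(1) by blast
  ultimately show ?thesis using affine_form_diff_vertical[OF \<phi>(1) x _ d y(2)[symmetric]] by simp
qed

lemma affine_hull_mem_determined_hyperplanes: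
  assumes "strongly_general_position d S" "1 \<le> d" "T \<subseteq> S" "T \<subseteq> A" "card T = d"
  shows "affine hull T \<in> determined_hyperplanes d A"
  using assms general_position_affine_subspace[of d S T "d - 1"]
  by (auto simp: determined_hyperplanes_def strongly_general_position_def)

lemma deep_below_imp_beyond:
  assumes sgp: "strongly_general_position d H" and d: "1 \<le> d"
    and sub: "A \<subseteq> H" "B \<subseteq> H" and deep: "deep_below d B A"
  shows "beyond d 1 A B" "beyond d (- 1) B A"
proof -
  have H: "H \<subseteq> coord_space d" using sgp by (rule strongly_general_position_coord_space)
  obtain A' B' where large: "A \<subseteq> A'" "B \<subseteq> B'" "deep_below_large d B' A'"
    using deep unfolding deep_below_def by blast
  note determined = affine_hull_mem_determined_hyperplanes[OF sgp d]
  show "beyond d 1 A B"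
    unfolding beyond_def
  proof (intro allI impI ballI)
    fix T \<phi> b
    assume T: "T \<subseteq> A" "card T = d" "\<phi> \<in> affine_forms d 1" "\<forall>t\<in>T. \<phi> t = 0" and b: "b \<in> B"
    then have "lies_below d b (affine hull T)"
      using large determined[of T A'] sub unfolding deep_below_large_def by blast
    then obtain y where y: "y \<in> affine hull T" "first_coords (d - 1) y = first_coords (d - 1) b"
      "coord (d - 1) b < coord (d - 1) y"
      unfolding lies_below_def by blast
    have "\<phi> b = 1 * (coord (d - 1) b - coord (d - 1) y)"
      using T(1) b sub H d
      by (intro affine_form_eq_height_over_hyperplane[OF T(3,4) _ _ _ y(1,2)]) auto
    then show "\<phi> b < 0" using y(3) by simp
  qed
  show "beyond d (- 1) B A"
    unfolding beyond_def
  proof (intro allI impI ballI)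
    fix T \<phi> a
    assume T: "T \<subseteq> B" "card T = d" "\<phi> \<in> affine_forms d (- 1)" "\<forall>t\<in>T. \<phi> t = 0" and a: "a \<in> A"
    then have "lies_above d a (affine hull T)"
      using large determined[of T B'] sub unfolding deep_below_large_def by blast
    then obtain y where y: "y \<in> affine hull T" "first_coords (d - 1) y = first_coords (d - 1) a"
      "coord (d - 1) y < coord (d - 1) a"
      unfolding lies_above_def by blast
    have "\<phi> a = - 1 * (coord (d - 1) a - coord (d - 1) y)"
      using T(1) a sub H d
      by (intro affine_form_eq_height_over_hyperplane[OF T(3,4) _ _ _ y(1,2)]) auto
    then show "\<phi> a < 0" using y(3) by simp
  qed
qed

section \<open>Residue classes and runs of consecutive points\<close>

lemma point_index_less:
  assumes "finite Q" "x \<in> Q" "coord 0 x < coord 0 y"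
  shows "point_index Q x < point_index Q y"
  unfolding point_index_def using assms by (intro psubset_card_mono) auto

lemma point_index_less_iff:
  assumes "finite Q" "x \<in> Q" "y \<in> Q"
  shows "point_index Q x < point_index Q y \<longleftrightarrow> coord 0 x < coord 0 y"
proof -
  have "point_index Q x = point_index Q y" if "coord 0 x = coord 0 y"
    using that by (simp add: point_index_def)
  then show ?thesis
    using point_index_less[of Q x y] point_index_less[of Q y x] assms
    by (cases "coord 0 x" "coord 0 y" rule: linorder_cases) auto
qed

lemma bij_betw_point_index:
  assumes "finite Q" "inj_on (coord 0) Q"
  shows "bij_betw (point_index Q) Q {..<card Q}"
proof -
  have inj: "inj_on (point_index Q) Q"
    using assms point_index_less_iff[OF assms(1)]
    by (intro inj_onI) (metis inj_onD linorder_neqE less_irrefl)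
  have "point_index Q x < card Q" if "x \<in> Q" for x
    unfolding point_index_def using assms(1) that by (intro psubset_card_mono) auto
  then have "point_index Q ` Q = {..<card Q}"
    using inj by (intro card_subset_eq) (auto simp: card_image)
  with inj show ?thesis by (simp add: bij_betw_def)
qed

lemma point_index_eq_iff:
  assumes "finite Q" "inj_on (coord 0) Q" "x \<in> Q" "y \<in> Q"
  shows "point_index Q x = point_index Q y \<longleftrightarrow> x = y"
  using bij_betw_imp_inj_on[OF bij_betw_point_index[OF assms(1,2)]] assms(3,4)
  by (rule inj_on_eq_iff)

lemma div_le_card_residue_class:
  fixes n p i :: nat
  assumes "i < p"
  shows "n div p \<le> card {m \<in> {..<n}. m mod p = i}"
proof -
  have "t * p + i < n" if "t < n div p" for t
  proof -
    have "t * p + i < Suc t * p" using assms by simp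
    also have "\<dots> \<le> n"
      using that by (metis Suc_leI div_times_less_eq_dividend le_trans mult_le_mono1)
    finally show ?thesis .
  qed
  then have "(\<lambda>t. t * p + i) ` {..<n div p} \<subseteq> {m \<in> {..<n}. m mod p = i}"
    using assms by auto
  moreover have "inj_on (\<lambda>t. t * p + i) {..<n div p}"
    using assms by (auto simp: inj_on_def)
  ultimately have "card {..<n div p} \<le> card {m \<in> {..<n}. m mod p = i}"
    by (intro card_inj_on_le) auto
  then show ?thesis by simp
qed

lemma div_le_card_residue_part:
  assumes Q: "finite Q" "inj_on (coord 0) Q" and i: "i < p"
  shows "card Q div p \<le> card (residue_part Q i p)"
proof -
  have "point_index Q ` residue_part Q i p = {m \<in> point_index Q ` Q. m mod p = i}"
    using i by (auto simp: residue_part_def)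
  also have "point_index Q ` Q = {..<card Q}"
    using bij_betw_point_index[OF Q] by (simp add: bij_betw_def)
  finally have "bij_betw (point_index Q) (residue_part Q i p) {m \<in> {..<card Q}. m mod p = i}"
    by (intro bij_betw_subset[OF bij_betw_point_index[OF Q]]) (auto simp: residue_part_def)
  then show ?thesis
    using div_le_card_residue_class[OF i] by (simp add: bij_betw_same_card)
qed

lemma residue_part_subset: "residue_part Q i p \<subseteq> Q"
  by (auto simp: residue_part_def)

lemma residue_part_disjoint:
  "i < p \<Longrightarrow> j < p \<Longrightarrow> i \<noteq> j \<Longrightarrow> residue_part Q i p \<inter> residue_part Q j p = {}"
  by (auto simp: residue_part_def)

lemma mem_residue_part_mod: "x \<in> Q \<Longrightarrow> x \<in> residue_part Q (point_index Q x mod p) p"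
  by (simp add: residue_part_def)

definition run :: "point set \<Rightarrow> nat \<Rightarrow> nat \<Rightarrow> point set" where
  "run Q i k = {q \<in> Q. point_index Q q \<in> {i..<i + k}}"

lemma run_subset: "run Q i k \<subseteq> Q"
  by (auto simp: run_def)

lemma bij_betw_point_index_run:
  assumes Q: "finite Q" "inj_on (coord 0) Q" and fits: "i + k \<le> card Q"
  shows "bij_betw (point_index Q) (run Q i k) {i..<i + k}"
proof (rule bij_betw_subset[OF bij_betw_point_index[OF Q] run_subset])
  have "{i..<i + k} \<subseteq> point_index Q ` Q"
    using fits bij_betw_point_index[OF Q] by (auto simp: bij_betw_def)
  then show "point_index Q ` run Q i k = {i..<i + k}"
    unfolding run_def by auto
qed

lemma card_run:
  "finite Q \<Longrightarrow> inj_on (coord 0) Q \<Longrightarrow> i + k \<le> card Q \<Longrightarrow> card (run Q i k) = k"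
  using bij_betw_same_card[OF bij_betw_point_index_run] by fastforce

lemma run_inject:
  assumes Q: "finite Q" "inj_on (coord 0) Q" and fits: "i + k \<le> card Q" "j + k \<le> card Q"
    and "1 \<le> k" and eq: "run Q i k = run Q j k"
  shows "i = j"
proof -
  have "{i..<i + k} = {j..<j + k}"
    using bij_betw_point_index_run[OF Q fits(1)] bij_betw_point_index_run[OF Q fits(2)] eq
    unfolding bij_betw_def by metis
  then show ?thesis using \<open>1 \<le> k\<close> by (simp add: atLeastLessThan_eq_iff)
qed

lemma div_2_le_card_if_runs_mem:
  assumes Q: "finite Q" "inj_on (coord 0) Q" and k: "1 \<le> k" and "finite \<W>" "c < 2"
    and runs: "\<And>i. i mod 2 = c \<Longrightarrow> i + k \<le> card Q \<Longrightarrow> run Q i k \<in> \<W>"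
  shows "(card Q - k) div 2 \<le> card \<W>"
proof -
  let ?R = "{..<(card Q - k) div 2}"
  have fits: "2 * r + c + k \<le> card Q" if "r \<in> ?R" for r
    using that \<open>c < 2\<close> unfolding lessThan_iff by linarith
  have "(\<lambda>r. run Q (2 * r + c) k) ` ?R \<subseteq> \<W>"
    using fits \<open>c < 2\<close> by (auto intro!: runs)
  moreover have "inj_on (\<lambda>r. run Q (2 * r + c) k) ?R"
    using run_inject[OF Q fits fits k] by (intro inj_onI) fastforce
  ultimately have "card ?R \<le> card \<W>"
    using \<open>finite \<W>\<close> by (intro card_inj_on_le)
  then show ?thesis by simp
qed

section \<open>Separated subsets\<close>

text \<open>Holes (\<open>hole = True\<close>) and islands (\<open>hole = False\<close>) are treated at once. With the separating
  functionals made explicit in \<open>P\<close>, no separation theorem is needed.\<close>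

definition separated_subsets :: "('a \<Rightarrow> 'a set \<Rightarrow> bool) \<Rightarrow> bool \<Rightarrow> 'a set \<Rightarrow> nat \<Rightarrow> 'a set set" where
  "separated_subsets P hole S k =
     {I. I \<subseteq> S \<and> card I = k \<and> (\<forall>x\<in>S. hole \<or> x \<notin> I \<longrightarrow> P x (I - {x}))}"

lemma finite_separated_subsets: "finite S \<Longrightarrow> finite (separated_subsets P hole S k)"
  by (rule finite_subset[of _ "Pow S"]) (auto simp: separated_subsets_def)

lemma separated_subsets_mono:
  "(\<And>x G. P x G \<Longrightarrow> Q x G) \<Longrightarrow> separated_subsets P hole S k \<subseteq> separated_subsets Q hole S k"
  by (auto simp: separated_subsets_def)

lemma separated_subset_is_island:
  assumes "I \<in> separated_subsets linearly_separated hole S k"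
  shows "is_island S k I"
proof -
  have "x \<in> I" if "x \<in> convex hull I" "x \<in> S" for x
  proof (rule ccontr)
    assume "x \<notin> I"
    then have "linearly_separated x I" using assms that(2) by (auto simp: separated_subsets_def)
    then show False using linearly_separated_not_in_convex_hull that(1) by blast
  qed
  then show ?thesis
    using assms hull_subset[of I convex] unfolding is_island_def separated_subsets_def by blast
qed

lemma separated_subset_is_hole:
  assumes "I \<in> separated_subsets linearly_separated True S k"
  shows "is_hole S k I"
  using assms separated_subset_is_island[OF assms] linearly_separated_not_in_convex_hull
  by (auto simp: is_hole_def convex_position_def separated_subsets_def)

lemma run_mem_separated_subsets:
  assumes d: "2 \<le> d" and Q: "finite Q" "inj_on (coord 0) Q" and fits: "i + k \<le> card Q"
    and interior: "\<And>x. hole \<Longrightarrow> x \<in> Q \<Longrightarrow> i < point_index Q x \<Longrightarrow> Suc (point_index Q x) < i + k \<Longrightarrow>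
      slope_separated d s x (run Q i k - {x})"
  shows "run Q i k \<in> separated_subsets (slope_separated d s) hole Q k"
proof -
  have "slope_separated d s x (run Q i k - {x})" if x: "x \<in> Q" "hole \<or> x \<notin> run Q i k" for x
  proof (cases "i < point_index Q x \<and> Suc (point_index Q x) < i + k")
    case True
    moreover from this have "hole" using x by (auto simp: run_def)
    ultimately show ?thesis using interior x(1) by blast
  next
    case False
    have "point_index Q g \<noteq> point_index Q x" if "g \<in> run Q i k - {x}" for g
      using that x(1) point_index_eq_iff[OF Q] by (auto simp: run_def)
    then have "(\<forall>g\<in>run Q i k - {x}. point_index Q g < point_index Q x) \<or>
        (\<forall>g\<in>run Q i k - {x}. point_index Q x < point_index Q g)"
      using False by (fastforce simp: run_def)
    then show ?thesis
      using d Q(1) x(1) run_subset[of Q i k] point_index_less_iff[OF Q(1)]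
      by (intro slope_separated_if_extreme_first_coord) (auto intro: finite_subset)
  qed
  then show ?thesis using card_run[OF Q fits] run_subset unfolding separated_subsets_def by blast
qed

lemma card_separated_subsets_projection:
  fixes d :: nat
  defines "\<pi> \<equiv> first_coords (d - 1)"
  assumes A: "finite A" "inj_on \<pi> A"
  shows "card (separated_subsets linearly_separated hole (\<pi> ` A) k)
    \<le> card (separated_subsets (slope_separated d s) hole A k)"
proof -
  let ?lift = "\<lambda>I. {x \<in> A. \<pi> x \<in> I}"
  have image: "\<pi> ` ?lift I = I" if "I \<subseteq> \<pi> ` A" for I using that by auto
  have "?lift I \<in> separated_subsets (slope_separated d s) hole A k"
    if I: "I \<in> separated_subsets linearly_separated hole (\<pi> ` A) k" for I
  proof -
    have sub: "I \<subseteq> \<pi> ` A" and card: "card I = k" using I by (auto simp: separated_subsets_def)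
    have "card (\<pi> ` ?lift I) = card (?lift I)"
      by (intro card_image inj_on_subset[OF A(2)]) auto
    then have "card (?lift I) = k" using image[OF sub] card by simp
    moreover have "slope_separated d s x (?lift I - {x})" if x: "x \<in> A" "hole \<or> x \<notin> ?lift I" for x
    proof (rule slope_separated_if_projection_separated)
      have "\<pi> ` (?lift I - {x}) = I - {\<pi> x}"
        using image[OF sub] A(2) x(1) by (auto dest: inj_onD)
      moreover have "linearly_separated (\<pi> x) (I - {\<pi> x})"
        using I x by (auto simp: separated_subsets_def)
      ultimately show "linearly_separated (first_coords (d - 1) x)
          (first_coords (d - 1) ` (?lift I - {x}))"
        by (simp add: \<pi>_def)
    qed (use A(1) in simp)
    ultimately show ?thesis unfolding separated_subsets_def by blast
  qed
  moreover have "inj_on ?lift (separated_subsets linearly_separated hole (\<pi> ` A) k)"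
    by (rule inj_on_inverseI[of _ "(`) \<pi>"]) (use image in \<open>auto simp: separated_subsets_def\<close>)
  ultimately show ?thesis
    by (intro card_inj_on_le[where f = ?lift] finite_separated_subsets A(1)) auto
qed

section \<open>Isolated pairs\<close>

definition isolated_pair :: "nat \<Rightarrow> point set \<Rightarrow> point set \<Rightarrow> point set \<Rightarrow> bool" where
  "isolated_pair d H A B \<longleftrightarrow>
     A \<subseteq> H \<and> B \<subseteq> H \<and> A \<inter> B = {} \<and> d \<le> card A \<and> d \<le> card B \<and>
     beyond d 1 A B \<and> beyond d (- 1) B A \<and>
     (\<forall>x\<in>H - (A \<union> B). \<exists>s. beyond d s (A \<union> B) {x})"

lemma linearly_separated_union_if_mem:
  assumes A: "strongly_general_position d A" "2 \<le> d" "d \<le> card A" and AB: "A \<inter> B = {}"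
    and beyond: "beyond d s A B" and E: "E \<in> separated_subsets (slope_separated d s) hole A k"
    and F: "F \<subseteq> B" "finite F" and x: "x \<in> A" "hole \<or> x \<notin> E"
  shows "linearly_separated x (E \<union> F - {x})"
proof -
  have "linearly_separated x ((E - {x}) \<union> F)"
    using E x F(2) beyond_mono[OF beyond F(1)]
    by (intro linearly_separated_union_if_beyond[OF A]) (auto simp: separated_subsets_def)
  moreover have "(E - {x}) \<union> F = E \<union> F - {x}" using AB F(1) x(1) by blast
  ultimately show ?thesis by simp
qed

lemma linearly_separated_union_if_isolated_pair:
  assumes H: "strongly_general_position d H" "2 \<le> d" and pair: "isolated_pair d H A B"
    and E: "E \<in> separated_subsets (slope_separated d 1) hole A k"
    and F: "F \<in> separated_subsets (slope_separated d (- 1)) hole B l"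
    and x: "x \<in> H" "hole \<or> x \<notin> E \<union> F"
  shows "linearly_separated x (E \<union> F - {x})"
proof -
  have AB: "A \<subseteq> H" "B \<subseteq> H" "A \<inter> B = {}" "B \<inter> A = {}" "d \<le> card A" "d \<le> card B"
    "beyond d 1 A B" "beyond d (- 1) B A"
    and others: "\<And>x. x \<in> H - (A \<union> B) \<Longrightarrow> \<exists>s. beyond d s (A \<union> B) {x}"
    using pair by (auto simp: isolated_pair_def)
  have sgp: "strongly_general_position d A" "strongly_general_position d B"
    "strongly_general_position d (A \<union> B)"
    using AB(1,2) by (auto intro: strongly_general_position_subset[OF H(1)])
  have EF: "E \<subseteq> A" "F \<subseteq> B" using E F by (auto simp: separated_subsets_def)
  have fin: "finite E" "finite F" "finite (A \<union> B)"
    using EF sgp by (auto dest: strongly_general_position_finite intro: finite_subset)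
  consider "x \<in> A" | "x \<in> B" | "x \<in> H - (A \<union> B)" using x(1) by blast
  then show ?thesis
  proof cases
    case 1
    then show ?thesis
      using linearly_separated_union_if_mem[OF sgp(1) H(2) AB(5,3,7) E EF(2) fin(2)] x(2) by blast
  next
    case 2
    then have "linearly_separated x (F \<union> E - {x})"
      using linearly_separated_union_if_mem[OF sgp(2) H(2) AB(6,4,8) F EF(1) fin(1)] x(2) by blast
    then show ?thesis by (simp add: Un_commute)
  next
    case 3
    obtain s where s: "beyond d s (A \<union> B) {x}" using others[OF 3] by blast
    have "d \<le> card (A \<union> B)" using AB(5) fin(3) by (meson card_mono le_trans sup_ge1)
    then have "slope_separated d (- s) x (E \<union> F - {x})"
      using EF s by (intro slope_separated_if_beyond[OF sgp(3) H(2)]) auto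
    then show ?thesis by (rule slope_separated_imp_linearly_separated)
  qed
qed

lemma union_mem_separated_subsets:
  assumes H: "strongly_general_position d H" "2 \<le> d" and AB: "isolated_pair d H A B"
    and E: "E \<in> separated_subsets (slope_separated d 1) hole A k"
    and F: "F \<in> separated_subsets (slope_separated d (- 1)) hole B l"
  shows "E \<union> F \<in> separated_subsets linearly_separated hole H (k + l)"
proof -
  have EF: "E \<subseteq> A" "F \<subseteq> B" "card E = k" "card F = l"
    using E F by (auto simp: separated_subsets_def)
  have sub: "A \<subseteq> H" "B \<subseteq> H" "A \<inter> B = {}" using AB by (auto simp: isolated_pair_def)
  then have "finite E" "finite F"
    using EF(1,2) strongly_general_position_finite[OF H(1)] by (meson finite_subset)+
  then have "card (E \<union> F) = k + l" using EF sub(3) by (subst card_Un_disjoint) auto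
  then show ?thesis
    using EF(1,2) sub(1,2) linearly_separated_union_if_isolated_pair[OF assms]
    unfolding separated_subsets_def by blast
qed

lemma card_separated_subsets_ge_mult:
  assumes H: "strongly_general_position d H" "2 \<le> d" and AB: "isolated_pair d H A B"
  shows "card (separated_subsets (slope_separated d 1) hole A k) *
      card (separated_subsets (slope_separated d (- 1)) hole B l)
    \<le> card (separated_subsets linearly_separated hole H (k + l))"
proof -
  let ?P = "separated_subsets (slope_separated d 1) hole A k \<times>
    separated_subsets (slope_separated d (- 1)) hole B l"
  have "(\<lambda>(E, F). E \<union> F) ` ?P \<subseteq> separated_subsets linearly_separated hole H (k + l)"
    using union_mem_separated_subsets[OF assms] by auto
  moreover have "inj_on (\<lambda>(E, F). E \<union> F) ?P"
  proof (rule inj_on_inverseI[of _ "\<lambda>I. (I \<inter> A, I \<inter> B)"], clarify)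
    fix E F assume "E \<in> separated_subsets (slope_separated d 1) hole A k"
      "F \<in> separated_subsets (slope_separated d (- 1)) hole B l"
    then have "E \<subseteq> A" "F \<subseteq> B" by (auto simp: separated_subsets_def)
    then show "(E \<union> F) \<inter> A = E \<and> (E \<union> F) \<inter> B = F"
      using AB unfolding isolated_pair_def by blast
  qed
  ultimately have "card ?P \<le> card (separated_subsets linearly_separated hole H (k + l))"
    using strongly_general_position_finite[OF H(1)]
    by (intro card_inj_on_le finite_separated_subsets)
  then show ?thesis by (simp add: card_cartesian_product)
qed

section \<open>Horton sets\<close>

lemma horton_strongly_general_position: "horton d H \<Longrightarrow> 2 \<le> d \<Longrightarrow> strongly_general_position d H"
  by (cases rule: horton.cases) auto

lemma horton_finite: "horton d H \<Longrightarrow> 2 \<le> d \<Longrightarrow> finite H"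
  using horton_strongly_general_position strongly_general_position_finite by blast

lemma horton_inj_on_first_coord: "horton d H \<Longrightarrow> 2 \<le> d \<Longrightarrow> inj_on (coord 0) H"
  using horton_strongly_general_position strongly_general_position_inj_on_first_coord by blast

lemma horton_first_coords:
  assumes "horton d H" "2 < d" "2 \<le> card H"
  shows "horton (d - 1) (first_coords (d - 1) ` H)"
  using assms by (cases rule: horton.cases) auto

lemma horton_residue_part:
  assumes H: "horton d H" and d: "2 \<le> d" and i: "i < horton_prime d"
  shows "horton d (residue_part H i (horton_prime d))"
  using H
proof (cases rule: horton.cases)
  case small
  have "card (residue_part H i (horton_prime d)) \<le> card H"
    using horton_finite[OF H d] residue_part_subset by (rule card_mono)
  then show ?thesis
    using small(3) strongly_general_position_subset[OF small(2) residue_part_subset]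
    by (intro horton.small[OF d]) auto
qed (use d i in auto)

lemma horton_deep_below_split:
  assumes "horton d H" "2 \<le> d" "2 \<le> card H" "I \<subseteq> {..<horton_prime d}" "2 \<le> card I"
  shows "\<exists>J\<subseteq>I. J \<noteq> {} \<and> I - J \<noteq> {} \<and>
    deep_below d (\<Union>j\<in>J. residue_part H j (horton_prime d))
                 (\<Union>i\<in>I - J. residue_part H i (horton_prime d))"
  using assms by (cases rule: horton.cases) auto

lemma horton_prime_ge_2: "2 \<le> horton_prime d"
proof -
  have "prime (horton_prime d)"
    unfolding horton_prime_def using enumerate_in_set[OF primes_infinite] by blast
  then show ?thesis by (rule prime_ge_2_nat)
qed

lemma horton_prime_2: "horton_prime 2 = 2"
  unfolding horton_prime_def enumerate.simps diff_self_eq_0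
  by (rule Least_equality) (auto simp: prime_ge_2_nat)

lemma deep_below_mono:
  "deep_below d B A \<Longrightarrow> B' \<subseteq> B \<Longrightarrow> A' \<subseteq> A \<Longrightarrow> deep_below d B' A'"
  unfolding deep_below_def by (meson subset_trans)

lemma recursive_splits_closest_pair:
  fixes R :: "'a set \<Rightarrow> 'a set \<Rightarrow> bool"
  assumes mono: "\<And>J K J' K'. R J K \<Longrightarrow> J' \<subseteq> J \<Longrightarrow> K' \<subseteq> K \<Longrightarrow> R J' K'"
    and split: "\<And>I. I \<subseteq> X \<Longrightarrow> 2 \<le> card I \<Longrightarrow> \<exists>J\<subseteq>I. J \<noteq> {} \<and> I - J \<noteq> {} \<and> R J (I - J)"
    and "finite X" "I \<subseteq> X" "2 \<le> card I"
  shows "\<exists>i\<in>I. \<exists>j\<in>I. i \<noteq> j \<and> R {j} {i} \<and> (\<forall>l\<in>I - {i, j}. R {l} {i, j} \<or> R {i, j} {l})"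
  using assms(4,5)
proof (induction "card I" arbitrary: I rule: less_induct)
  case less
  have fin: "finite I" using less.prems(1) \<open>finite X\<close> by (rule finite_subset)
  obtain J where J: "J \<subseteq> I" "J \<noteq> {}" "I - J \<noteq> {}" "R J (I - J)"
    using split[OF less.prems] by blast
  have descend: ?case
    if K: "K \<subset> I" "2 \<le> card K" and rest: "\<And>l. l \<in> I - K \<Longrightarrow> R {l} K \<or> R K {l}" for K
  proof -
    obtain i j where ij: "i \<in> K" "j \<in> K" "i \<noteq> j" "R {j} {i}"
      "\<forall>l\<in>K - {i, j}. R {l} {i, j} \<or> R {i, j} {l}"
      using less.hyps[of K] psubset_card_mono[OF fin K(1)] K less.prems(1) by auto
    have "R {l} {i, j} \<or> R {i, j} {l}" if "l \<in> I - {i, j}" for l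
      using ij that rest[of l] mono[of "{l}" K "{l}" "{i, j}"] mono[of K "{l}" "{i, j}" "{l}"]
      by blast
    then show ?thesis using ij K(1) by blast
  qed
  consider "2 \<le> card J" | "2 \<le> card (I - J)" | "card J < 2" "card (I - J) < 2" by linarith
  then show ?case
  proof cases
    case 1
    then show ?thesis using J mono[OF J(4)] by (intro descend[of J]) auto
  next
    case 2
    then show ?thesis using J mono[OF J(4)] by (intro descend[of "I - J"]) auto
  next
    case 3
    have "finite J" "finite (I - J)" using fin J(1) by (auto intro: finite_subset)
    then have "card J = 1" "card (I - J) = 1" using 3 J(2,3) by (auto simp: less_2_cases_iff)
    then obtain i j where ij: "J = {j}" "I - J = {i}" by (auto simp: card_1_singleton_iff)
    then have "I = {i, j}" "i \<noteq> j" using J(1) by auto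
    then show ?thesis using J(4) ij by auto
  qed
qed

lemma horton_closest_residue_parts:
  fixes H :: "point set" and d :: nat
  defines "C \<equiv> \<lambda>i. residue_part H i (horton_prime d)"
  assumes H: "horton d H" "2 \<le> d" "2 \<le> card H"
  shows "\<exists>i<horton_prime d. \<exists>j<horton_prime d. i \<noteq> j \<and> deep_below d (C j) (C i) \<and>
    (\<forall>l<horton_prime d. l \<noteq> i \<longrightarrow> l \<noteq> j \<longrightarrow>
      deep_below d (C l) (C i \<union> C j) \<or> deep_below d (C i \<union> C j) (C l))"
proof -
  define R where "R = (\<lambda>J K. deep_below d (\<Union>j\<in>J. C j) (\<Union>i\<in>K. C i))"
  let ?X = "{..<horton_prime d}"
  have "\<exists>i\<in>?X. \<exists>j\<in>?X. i \<noteq> j \<and> R {j} {i} \<and> (\<forall>l\<in>?X - {i, j}. R {l} {i, j} \<or> R {i, j} {l})"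
  proof (rule recursive_splits_closest_pair)
    show "\<exists>J\<subseteq>I. J \<noteq> {} \<and> I - J \<noteq> {} \<and> R J (I - J)" if "I \<subseteq> ?X" "2 \<le> card I" for I
      unfolding R_def C_def using horton_deep_below_split[OF H that] .
    show "R J K \<Longrightarrow> J' \<subseteq> J \<Longrightarrow> K' \<subseteq> K \<Longrightarrow> R J' K'" for J K J' K'
      unfolding R_def by (rule deep_below_mono) auto
  qed (use horton_prime_ge_2 in auto)
  then obtain i j where "i \<in> ?X" "j \<in> ?X" "i \<noteq> j" "R {j} {i}"
    "\<forall>l\<in>?X - {i, j}. R {l} {i, j} \<or> R {i, j} {l}"
    by blast
  then show ?thesis by (intro exI[of _ i] conjI exI[of _ j]) (auto simp: R_def)
qed

lemma horton_isolated_pair: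
  fixes H :: "point set" and d :: nat
  defines "C \<equiv> \<lambda>i. residue_part H i (horton_prime d)"
  assumes H: "horton d H" and d: "2 \<le> d" and large: "d * horton_prime d \<le> card H"
  shows "\<exists>i<horton_prime d. \<exists>j<horton_prime d. i \<noteq> j \<and> isolated_pair d H (C i) (C j)"
proof -
  let ?p = "horton_prime d"
  have sgp: "strongly_general_position d H" using H d by (rule horton_strongly_general_position)
  have "2 * 1 \<le> d * ?p" using d horton_prime_ge_2[of d] by (intro mult_le_mono) auto
  then have "2 \<le> card H" using large by simp
  then obtain i j where ij: "i < ?p" "j < ?p" "i \<noteq> j" and deep: "deep_below d (C j) (C i)"
    and others: "\<forall>l<?p. l \<noteq> i \<longrightarrow> l \<noteq> j \<longrightarrow>
      deep_below d (C l) (C i \<union> C j) \<or> deep_below d (C i \<union> C j) (C l)"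
    using horton_closest_residue_parts[OF H d] unfolding C_def by blast
  have sub: "C l \<subseteq> H" for l by (simp add: C_def residue_part_subset)
  note beyond = deep_below_imp_beyond[OF sgp order_trans[OF one_le_numeral d]]
  have "d \<le> card H div ?p"
    using large horton_prime_ge_2[of d] by (simp add: less_eq_div_iff_mult_less_eq)
  then have "d \<le> card (C l)" if "l < ?p" for l
    using div_le_card_residue_part[OF horton_finite[OF H d] horton_inj_on_first_coord[OF H d] that]
    unfolding C_def by linarith
  moreover have "\<exists>s. beyond d s (C i \<union> C j) {x}" if x: "x \<in> H - (C i \<union> C j)" for x
  proof -
    define l where "l = point_index H x mod ?p"
    have xl: "x \<in> C l" using x mem_residue_part_mod[of x H ?p] by (simp add: C_def l_def)
    have "l < ?p" unfolding l_def using horton_prime_ge_2[of d] by (intro mod_less_divisor) simp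
    moreover have "l \<noteq> i" "l \<noteq> j" using x xl by auto
    ultimately consider "deep_below d (C l) (C i \<union> C j)" | "deep_below d (C i \<union> C j) (C l)"
      using others by blast
    then have "\<exists>s. beyond d s (C i \<union> C j) (C l)"
      using beyond(1)[of "C i \<union> C j" "C l"] beyond(2)[of "C l" "C i \<union> C j"] sub by cases auto
    then show ?thesis using xl beyond_mono by blast
  qed
  ultimately have "isolated_pair d H (C i) (C j)"
    using ij sub beyond[OF sub sub deep] residue_part_disjoint[of i ?p j]
    by (auto simp: isolated_pair_def C_def)
  then show ?thesis using ij by blast
qed

lemma planar_horton_beyond_residue_part:
  assumes A: "horton 2 A" "4 \<le> card A" and s: "s \<in> {1, - 1}"
  shows "\<exists>c<2. beyond 2 (- s) (residue_part A c 2) (residue_part A (1 - c) 2)"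
proof -
  obtain i j :: nat where ij: "i < 2" "j < 2" "i \<noteq> j"
    and pair: "isolated_pair 2 A (residue_part A i 2) (residue_part A j 2)"
    using horton_isolated_pair[OF A(1)] A(2) by (auto simp: horton_prime_2)
  have "j = 1 - i" "i = 1 - j" using ij by auto
  then show ?thesis
    using pair ij s unfolding isolated_pair_def by auto
qed

section \<open>Counting\<close>

definition horton_growth :: "nat \<Rightarrow> nat \<Rightarrow> (point set \<Rightarrow> nat) \<Rightarrow> bool" where
  "horton_growth d e F \<longleftrightarrow>
     (\<exists>c>0. \<exists>N. \<forall>H. horton d H \<and> N \<le> card H \<longrightarrow> c * real (card H) ^ e \<le> real (F H))"

lemma horton_growthI:
  assumes "c > 0" "\<And>H. horton d H \<Longrightarrow> N \<le> card H \<Longrightarrow> c * real (card H) ^ e \<le> real (F H)"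
  shows "horton_growth d e F"
  unfolding horton_growth_def using assms by blast

lemma horton_growthE:
  assumes "horton_growth d e F"
  obtains c N where "c > 0" "\<And>H. horton d H \<Longrightarrow> N \<le> card H \<Longrightarrow> c * real (card H) ^ e \<le> real (F H)"
  using assms unfolding horton_growth_def by blast

lemma horton_growth_mono:
  assumes "horton_growth d e F" "\<And>H. horton d H \<Longrightarrow> F H \<le> G H"
  shows "horton_growth d e G"
  using assms unfolding horton_growth_def by (meson of_nat_mono order_trans)

lemma real_div_nat_ge_half:
  fixes n p :: nat
  assumes "0 < p" "p \<le> n"
  shows "real n / (2 * real p) \<le> real (n div p)"
proof -
  have "n < p * (n div p) + p"
    using assms(1) by (metis add_strict_left_mono mod_less_divisor mult_div_mod_eq)
  moreover have "p \<le> p * (n div p)" using assms by (simp add: Suc_le_eq div_greater_zero_iff)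
  ultimately have "n \<le> 2 * (p * (n div p))" by linarith
  then have "real n \<le> real (2 * (p * (n div p)))" by (rule of_nat_mono)
  then show ?thesis using assms(1) by (simp add: field_simps)
qed

lemma horton_growth_on_fraction:
  assumes "horton_growth d e F" and p: "0 < p"
  obtains c N where "c > 0"
    "\<And>n A. N \<le> n \<Longrightarrow> horton d A \<Longrightarrow> n div p \<le> card A \<Longrightarrow> c * real n ^ e \<le> real (F A)"
proof -
  obtain b M where b: "b > 0"
    "\<And>A. horton d A \<Longrightarrow> M \<le> card A \<Longrightarrow> b * real (card A) ^ e \<le> real (F A)"
    using assms(1) by (rule horton_growthE) blast
  show ?thesis
  proof (rule that)
    show "0 < b / (2 * real p) ^ e" using b(1) p by simp
    fix n A assume n: "max M 1 * p \<le> n" and A: "horton d A" "n div p \<le> card A"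
    have "max M 1 \<le> n div p" using n p by (simp only: less_eq_div_iff_mult_less_eq)
    then have "M \<le> card A" "p \<le> n" using A(2) by (auto simp: div_greater_zero_iff Suc_le_eq)
    then have "real n / (2 * real p) \<le> real (card A)"
      using real_div_nat_ge_half[OF p \<open>p \<le> n\<close>] A(2) by linarith
    then have "b * (real n / (2 * real p)) ^ e \<le> b * real (card A) ^ e"
      using b(1) by (intro mult_left_mono power_mono) auto
    also have "\<dots> \<le> F A" using b(2) A(1) \<open>M \<le> card A\<close> by blast
    finally show "b / (2 * real p) ^ e * real n ^ e \<le> F A" by (simp add: power_divide)
  qed
qed

lemma horton_growth_mult:
  assumes F: "horton_growth d e F" and G: "horton_growth d e' G" and p: "0 < p"
    and parts: "\<And>H. horton d H \<Longrightarrow> M \<le> card H \<Longrightarrow> \<exists>A B. horton d A \<and> horton d B \<and>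
      card H div p \<le> card A \<and> card H div p \<le> card B \<and> F A * G B \<le> L H"
  shows "horton_growth d (e + e') L"
proof -
  obtain b N where b: "b > 0"
    "\<And>n A. N \<le> n \<Longrightarrow> horton d A \<Longrightarrow> n div p \<le> card A \<Longrightarrow> b * real n ^ e \<le> F A"
    using F p by (rule horton_growth_on_fraction) blast
  obtain c N' where c: "c > 0"
    "\<And>n B. N' \<le> n \<Longrightarrow> horton d B \<Longrightarrow> n div p \<le> card B \<Longrightarrow> c * real n ^ e' \<le> G B"
    using G p by (rule horton_growth_on_fraction) blast
  show ?thesis
  proof (rule horton_growthI)
    show "0 < b * c" using b(1) c(1) by simp
    fix H assume H: "horton d H" "max M (max N N') \<le> card H"
    obtain A B where AB: "horton d A" "horton d B" "card H div p \<le> card A" "card H div p \<le> card B"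
      "F A * G B \<le> L H"
      using parts[of H] H by auto
    have "b * c * real (card H) ^ (e + e') = (b * real (card H) ^ e) * (c * real (card H) ^ e')"
      by (simp add: power_add)
    also have "\<dots> \<le> real (F A) * real (G B)"
      using b(1) c(1) H AB by (intro mult_mono b(2) c(2)) auto
    also have "\<dots> \<le> L H" using AB(5) by (metis of_nat_mono of_nat_mult)
    finally show "b * c * real (card H) ^ (e + e') \<le> L H" .
  qed
qed

lemma horton_growth_separated_subsets_add:
  assumes d: "2 \<le> d"
    and A: "horton_growth d e (\<lambda>A. card (separated_subsets (slope_separated d 1) hole A k))"
    and B: "horton_growth d e' (\<lambda>B. card (separated_subsets (slope_separated d (- 1)) hole B l))"
  shows "horton_growth d (e + e') (\<lambda>H. card (separated_subsets linearly_separated hole H (k + l)))"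
proof (rule horton_growth_mult[OF A B])
  let ?p = "horton_prime d"
  show "0 < ?p" using horton_prime_ge_2[of d] by simp
  fix H assume H: "horton d H" "d * ?p \<le> card H"
  obtain i j where ij: "i < ?p" "j < ?p"
    and pair: "isolated_pair d H (residue_part H i ?p) (residue_part H j ?p)"
    using horton_isolated_pair[OF H(1) d H(2)] by blast
  have "card H div ?p \<le> card (residue_part H l ?p)" if "l < ?p" for l
    using horton_finite[OF H(1) d] horton_inj_on_first_coord[OF H(1) d] that
    by (rule div_le_card_residue_part)
  then show "\<exists>A B. horton d A \<and> horton d B \<and> card H div ?p \<le> card A \<and> card H div ?p \<le> card B \<and>
      card (separated_subsets (slope_separated d 1) hole A k) *
        card (separated_subsets (slope_separated d (- 1)) hole B l)
      \<le> card (separated_subsets linearly_separated hole H (k + l))"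
    using ij horton_residue_part[OF H(1) d]
      card_separated_subsets_ge_mult[OF horton_strongly_general_position[OF H(1) d] d pair]
    by blast
qed

lemma horton_growth_projection:
  assumes lower: "horton_growth d e (\<lambda>H. card (separated_subsets linearly_separated hole H k))"
    and d: "2 \<le> d"
  shows "horton_growth (Suc d) e
    (\<lambda>A. card (separated_subsets (slope_separated (Suc d) s) hole A k))"
proof -
  obtain c N where c: "c > 0" "\<And>H. horton d H \<Longrightarrow> N \<le> card H \<Longrightarrow>
      c * real (card H) ^ e \<le> card (separated_subsets linearly_separated hole H k)"
    using lower by (rule horton_growthE) blast
  show ?thesis
  proof (rule horton_growthI[OF c(1)])
    fix A assume A: "horton (Suc d) A" "max 2 N \<le> card A"
    let ?P = "first_coords d ` A"
    have inj: "inj_on (first_coords d) A"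
      using horton_inj_on_first_coord[OF A(1)] d by (intro inj_on_first_coords) auto
    have card: "card ?P = card A" using inj by (rule card_image)
    have "horton d ?P" using horton_first_coords[OF A(1)] A(2) d by auto
    then have "c * real (card A) ^ e \<le> card (separated_subsets linearly_separated hole ?P k)"
      using c(2)[of ?P] A(2) card by simp
    also have "\<dots> \<le> card (separated_subsets (slope_separated (Suc d) s) hole A k)"
      using card_separated_subsets_projection[of A "Suc d"] horton_finite[OF A(1)] inj d by simp
    finally show "c * real (card A) ^ e
      \<le> card (separated_subsets (slope_separated (Suc d) s) hole A k)" .
  qed
qed

lemma horton_growth_runs:
  assumes d: "2 \<le> d" and k: "1 \<le> k"
    and runs: "\<And>A. horton d A \<Longrightarrow> N \<le> card A \<Longrightarrow> \<exists>c<2. \<forall>i. i mod 2 = c \<longrightarrow> i + k \<le> card A \<longrightarrow>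
      run A i k \<in> separated_subsets P hole A k"
  shows "horton_growth d 1 (\<lambda>A. card (separated_subsets P hole A k))"
proof (rule horton_growthI)
  show "(0::real) < 1 / 4" by simp
  fix A assume A: "horton d A" "max N (2 * k + 2) \<le> card A"
  obtain c where "c < 2"
    "\<And>i. i mod 2 = c \<Longrightarrow> i + k \<le> card A \<Longrightarrow> run A i k \<in> separated_subsets P hole A k"
    using runs[of A] A by auto
  then have "(card A - k) div 2 \<le> card (separated_subsets P hole A k)"
    using horton_finite[OF A(1) d] horton_inj_on_first_coord[OF A(1) d] k
    by (intro div_2_le_card_if_runs_mem finite_separated_subsets)
  moreover have "card A \<le> 4 * ((card A - k) div 2)" using A(2) by linarith
  ultimately have "card A \<le> 4 * card (separated_subsets P hole A k)" by linarith
  then show "1 / 4 * real (card A) ^ 1 \<le> real (card (separated_subsets P hole A k))" by simp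
qed

text \<open>Every other run of three points is such that its middle point is above (\<open>s = 1\<close>) or below
  (\<open>s = - 1\<close>) the line through the other two.\<close>

lemma horton_growth_plane:
  assumes k: "1 \<le> k" "hole \<longrightarrow> k \<le> 3" and s: "s \<in> {1, - 1}"
  shows "horton_growth 2 1 (\<lambda>A. card (separated_subsets (slope_separated 2 s) hole A k))"
proof (rule horton_growth_runs[OF order_refl k(1)])
  fix A assume A: "horton 2 A" "4 \<le> card A"
  have sgp: "strongly_general_position 2 A"
    using A(1) by (simp add: horton_strongly_general_position)
  have fin: "finite A" and inj: "inj_on (coord 0) A"
    using A(1) by (simp_all add: horton_finite horton_inj_on_first_coord)
  obtain c where c: "c < 2" "beyond 2 (- s) (residue_part A c 2) (residue_part A (1 - c) 2)"
    using planar_horton_beyond_residue_part[OF A s] by blast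
  have "run A i k \<in> separated_subsets (slope_separated 2 s) hole A k"
    if i: "i mod 2 = c" "i + k \<le> card A" for i
  proof (rule run_mem_separated_subsets[OF order_refl fin inj i(2)])
    fix x assume "hole" and x: "x \<in> A" "i < point_index A x" "Suc (point_index A x) < i + k"
    then have middle: "point_index A x = i + 1" "k = 3" using k(2) by auto
    have "point_index A g = i \<or> point_index A g = i + 2" if g: "g \<in> run A i k - {x}" for g
    proof -
      have "point_index A g \<noteq> point_index A x"
        using g x(1) point_index_eq_iff[OF fin inj] by (auto simp: run_def)
      moreover have "i \<le> point_index A g" "point_index A g < i + 3"
        using g middle(2) by (auto simp: run_def)
      ultimately show ?thesis using middle(1) by linarith
    qed
    then have "run A i k - {x} \<subseteq> residue_part A c 2"
      using i(1) c(1) by (fastforce simp: residue_part_def run_def)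
    moreover have "x \<in> residue_part A (1 - c) 2"
      using x(1) middle(1) i(1) c(1) by (auto simp: residue_part_def less_2_cases_iff mod_Suc)
    moreover have "2 \<le> card (residue_part A c 2)"
      using div_le_card_residue_part[OF fin inj c(1)] A(2) by linarith
    ultimately have "slope_separated 2 (- (- s)) x (run A i k - {x})"
      using c(2) beyond_mono strongly_general_position_subset[OF sgp residue_part_subset]
      by (intro slope_separated_if_beyond[of 2 "residue_part A c 2"]) auto
    then show "slope_separated 2 s x (run A i k - {x})" by simp
  qed
  then show "\<exists>c<2. \<forall>i. i mod 2 = c \<longrightarrow> i + k \<le> card A \<longrightarrow>
      run A i k \<in> separated_subsets (slope_separated 2 s) hole A k"
    using c(1) by blast
qed

lemma horton_growth_singletons:
  assumes d: "2 \<le> d"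
  shows "horton_growth d 1 (\<lambda>H. card (separated_subsets linearly_separated hole H 1))"
proof (rule horton_growth_runs[OF d order_refl])
  fix H assume H: "horton d H"
  have "run H i 1 \<in> separated_subsets linearly_separated hole H 1" if "i + 1 \<le> card H" for i
  proof -
    have "run H i 1 \<in> separated_subsets (slope_separated d 0) hole H 1"
      using d horton_finite[OF H d] horton_inj_on_first_coord[OF H d] that
      by (rule run_mem_separated_subsets) simp
    then show ?thesis
      using separated_subsets_mono[of "slope_separated d 0" linearly_separated]
        slope_separated_imp_linearly_separated by blast
  qed
  then show "\<exists>c<2. \<forall>i. i mod 2 = c \<longrightarrow> i + 1 \<le> card H \<longrightarrow>
      run H i 1 \<in> separated_subsets linearly_separated hole H 1"
    by (intro exI[of _ 0]) simp
qed

lemma horton_growth_halves: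
  assumes d: "2 \<le> d" and m: "1 \<le> m" and k: "1 \<le> k" "hole \<longrightarrow> k \<le> 3 * (2 * m)"
    and half: "\<And>l s. 1 \<le> l \<Longrightarrow> hole \<longrightarrow> l \<le> 3 * m \<Longrightarrow> s \<in> {1, - 1} \<Longrightarrow>
      horton_growth d (min m l) (\<lambda>A. card (separated_subsets (slope_separated d s) hole A l))"
  shows "horton_growth d (min (2 * m) k) (\<lambda>H. card (separated_subsets linearly_separated hole H k))"
proof (cases "k = 1")
  case True
  then show ?thesis using horton_growth_singletons[OF d, of hole] m by simp
next
  case False
  define l where "l = k div 2"
  define l' where "l' = k - k div 2"
  have "1 \<le> l" "1 \<le> l'" "hole \<longrightarrow> l \<le> 3 * m" "hole \<longrightarrow> l' \<le> 3 * m"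
    using k False unfolding l_def l'_def by auto
  then have "horton_growth d (min m l + min m l')
      (\<lambda>H. card (separated_subsets linearly_separated hole H (l + l')))"
    by (intro horton_growth_separated_subsets_add[OF d] half) auto
  moreover have "min m l + min m l' = min (2 * m) k" "l + l' = k"
    unfolding l_def l'_def by auto
  ultimately show ?thesis by simp
qed

lemma horton_growth_slope_separated:
  assumes "2 \<le> d" "1 \<le> k" "hole \<longrightarrow> k \<le> 3 * 2 ^ (d - 2)" "s \<in> {1, - 1}"
  shows "horton_growth d (min (2 ^ (d - 2)) k)
    (\<lambda>A. card (separated_subsets (slope_separated d s) hole A k))"
  using assms
proof (induction d arbitrary: k s rule: nat_induct_at_least)
  case base
  then show ?case using horton_growth_plane[of k hole s] by simp
next
  case (Suc d)
  have "Suc d - 2 = Suc (d - 2)" using Suc.hyps by linarith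
  then have pow: "(2::nat) ^ (Suc d - 2) = 2 * 2 ^ (d - 2)" by (simp only: power_Suc)
  have "horton_growth d (min (2 * 2 ^ (d - 2)) k)
      (\<lambda>H. card (separated_subsets linearly_separated hole H k))"
    using Suc.hyps Suc.prems[unfolded pow] Suc.IH by (intro horton_growth_halves) auto
  then show ?case unfolding pow using Suc.hyps by (rule horton_growth_projection)
qed

lemma horton_growth_linearly_separated:
  assumes d: "2 \<le> d" and k: "1 \<le> k" "hole \<longrightarrow> k \<le> 3 * 2 ^ (d - 1)"
  shows "horton_growth d (min (2 ^ (d - 1)) k)
    (\<lambda>H. card (separated_subsets linearly_separated hole H k))"
proof -
  have "d - 1 = Suc (d - 2)" using d by linarith
  then have pow: "(2::nat) ^ (d - 1) = 2 * 2 ^ (d - 2)" by (simp only: power_Suc)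
  show ?thesis
    using d k unfolding pow by (intro horton_growth_halves horton_growth_slope_separated) auto
qed

lemma finite_islands: "finite H \<Longrightarrow> finite {I. is_island H k I}"
  by (rule finite_subset[of _ "Pow H"]) (auto simp: is_island_def)

lemma finite_holes: "finite H \<Longrightarrow> finite {I. is_hole H k I}"
  by (rule finite_subset[OF _ finite_islands]) (auto simp: is_hole_def)

theorem theorem5:
  fixes d k :: nat
  assumes "2 \<le> d" and "1 \<le> k"
  shows "(\<exists>c>0. \<exists>N. \<forall>H. horton d H \<and> N \<le> card H \<longrightarrow>
            real (card {I. is_island H k I}) \<ge> c * real (card H) ^ min (2 ^ (d - 1)) k) \<and>
         (k \<le> 3 * 2 ^ (d - 1) \<longrightarrow>
           (\<exists>c>0. \<exists>N. \<forall>H. horton d H \<and> N \<le> card H \<longrightarrow>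
              real (card {I. is_hole H k I}) \<ge> c * real (card H) ^ min (2 ^ (d - 1)) k))"
proof -
  let ?e = "min (2 ^ (d - 1)) k"
  have "horton_growth d ?e (\<lambda>H. card {I. is_island H k I})"
  proof (rule horton_growth_mono)
    show "horton_growth d ?e (\<lambda>H. card (separated_subsets linearly_separated False H k))"
      using assms by (intro horton_growth_linearly_separated) auto
    show "card (separated_subsets linearly_separated False H k) \<le> card {I. is_island H k I}"
      if "horton d H" for H
      using separated_subset_is_island horton_finite[OF that assms(1)]
      by (intro card_mono finite_islands) auto
  qed
  moreover have "horton_growth d ?e (\<lambda>H. card {I. is_hole H k I})" if "k \<le> 3 * 2 ^ (d - 1)"
  proof (rule horton_growth_mono)
    show "horton_growth d ?e (\<lambda>H. card (separated_subsets linearly_separated True H k))"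
      using assms that by (intro horton_growth_linearly_separated) auto
    show "card (separated_subsets linearly_separated True H k) \<le> card {I. is_hole H k I}"
      if "horton d H" for H
      using separated_subset_is_hole horton_finite[OF that assms(1)]
      by (intro card_mono finite_holes) auto
  qed
  ultimately show ?thesis unfolding horton_growth_def by blast
qed

end
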